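(* If arbitrary complex weights are allowed, then for $n\ge 6$ even a $p\times q$ rectangle admits a signed tiling by $\mathcal{T}_n^+$ if and only if at least one of $p,q$ is even; and a $p\times q$ rectangle admits a signed tiling by $\mathcal{T}_4^+$ if and only if both $p$ and $q$ are even.
   Context: Identify the unit cell $[a,a+1]\times[b,b+1]$ with $(a,b)\in\mathbb{Z}^2$. For $n$ even, $\mathcal{T}_n$ consists of all integer translates of the polyominoes with cell sets $\{(0,j):0\le j\le n-2\}\cup\{(1,0)\}$, $\{(1,j):0\le j\le n-2\}\cup\{(0,n-2)\}$, $\{(i,0):0\le i\le n-2\}\cup\{(0,1)\}$, $\{(i,1):0\le i\le n-2\}\cup\{(n-2,0)\}$ (translations only); $\mathcal{T}_n^+$ is $\mathcal{T}_n$ together with all translates of the $2\times2$ square. A signed tiling with complex weights of a rectangle $R$ is a finite collection of translated tiles, each with a complex weight, such that the weights of the tiles covering each cell sum to $1$ on cells of $R$ and to $0$ elsewhere. *)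

theory Defs
  imports Complex_Main
begin

text \<open>A cell \<open>[a,a+1] \<times> [b,b+1]\<close> of the square lattice is identified with its lower left
  corner \<open>(a,b)\<close>.\<close>

type_synonym cell = "int \<times> int"

definition translate :: "int \<times> int \<Rightarrow> cell set \<Rightarrow> cell set" where
  "translate v P = (\<lambda>c. (fst c + fst v, snd c + snd v)) ` P"

definition translates :: "cell set set \<Rightarrow> cell set set" where
  "translates \<P> = {translate v P | v P. P \<in> \<P>}"

definition L_polyominoes :: "nat \<Rightarrow> cell set set" where
  "L_polyominoes n =
    {{(0, j) | j. 0 \<le> j \<and> j \<le> int n - 2} \<union> {(1, 0)},
     {(1, j) | j. 0 \<le> j \<and> j \<le> int n - 2} \<union> {(0, int n - 2)},
     {(i, 0) | i. 0 \<le> i \<and> i \<le> int n - 2} \<union> {(0, 1)},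
     {(i, 1) | i. 0 \<le> i \<and> i \<le> int n - 2} \<union> {(int n - 2, 0)}}"

definition square2 :: "cell set" where
  "square2 = {(0, 0), (1, 0), (0, 1), (1, 1)}"

definition tiles :: "nat \<Rightarrow> cell set set" where
  "tiles n = translates (L_polyominoes n)"

definition tiles_plus :: "nat \<Rightarrow> cell set set" where
  "tiles_plus n = tiles n \<union> translates {square2}"

definition rectangle :: "int \<Rightarrow> int \<Rightarrow> nat \<Rightarrow> nat \<Rightarrow> cell set" where
  "rectangle a b p q = {a..<a + int p} \<times> {b..<b + int q}"

text \<open>A signed tiling is a finite set \<open>F\<close> of tiles with a weight \<open>w T\<close> for each \<open>T \<in> F\<close>.
  Repeated copies of a tile are not represented separately: their weights add up.\<close>

definition signed_tiling ::
  "cell set set \<Rightarrow> cell set \<Rightarrow> cell set set \<Rightarrow> (cell set \<Rightarrow> complex) \<Rightarrow> bool" where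
  "signed_tiling \<T> R F w \<longleftrightarrow> finite F \<and> F \<subseteq> \<T> \<and>
     (\<forall>c. (\<Sum>T | T \<in> F \<and> c \<in> T. w T) = (if c \<in> R then 1 else 0))"

definition admits_signed_tiling :: "cell set set \<Rightarrow> cell set \<Rightarrow> bool" where
  "admits_signed_tiling \<T> R \<longleftrightarrow> (\<exists>F w. signed_tiling \<T> R F w)"

end

theory Submission
  imports Defs "HOL-Library.Poly_Mapping" "HOL-Library.Product_Plus"
begin

text \<open>Encode a cell \<open>(i,j)\<close> as the monomial \<open>x^i y^j\<close>; the signed tilings then form the ideal of
  \<open>\<complex>[x\<^sup>\<plusminus>\<^sup>1, y\<^sup>\<plusminus>\<^sup>1]\<close> generated by the tile polynomials. Put \<open>u = 1 + x\<close>, \<open>v = 1 + y\<close> and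
  \<open>k = (n - 2) / 2\<close>. The square gives \<open>uv\<close>, and two of the L-shaped tiles give
  \<open>u - kv + v\<^sup>2H\<close> and \<open>v - ku + u\<^sup>2H'\<close>. Multiplying these by \<open>u\<close> and \<open>v\<close> puts \<open>u\<^sup>2\<close> and \<open>v\<^sup>2\<close> in the
  ideal, hence also \<open>u - kv\<close> and \<open>v - ku\<close>, hence \<open>(k\<^sup>2 - 1)u\<close>. For \<open>n \<ge> 6\<close> this makes both dominoes
  tileable. Conversely all tiles vanish at \<open>(-1,-1)\<close>, and for \<open>n = 4\<close>, where \<open>k = 1\<close>, so does
  their derivative in the direction \<open>(1,1)\<close>.\<close>

section \<open>The ideal of signed tilings\<close>

text \<open>Finitely supported functions on the group of cells under convolution; with componentwise
  addition of pairs this is the ring of Laurent polynomials in two variables.\<close>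

type_synonym laurent = "cell \<Rightarrow>\<^sub>0 complex"

definition cells_poly :: "complex \<Rightarrow> cell set \<Rightarrow> laurent" where
  "cells_poly z P = (\<Sum>c\<in>P. Poly_Mapping.single c z)"

lemma lookup_cells_poly:
  "finite P \<Longrightarrow> Poly_Mapping.lookup (cells_poly z P) c = (if c \<in> P then z else 0)"
  by (simp add: cells_poly_def lookup_sum lookup_single when_def)

lemma finite_translate: "finite P \<Longrightarrow> finite (translate v P)"
  by (simp add: translate_def)

lemma inj_translate: "inj_on (\<lambda>c::cell. (fst c + fst v, snd c + snd v)) P"
  by (auto simp: inj_on_def prod_eq_iff)

lemma sum_translate:
  "sum f (translate v P) = (\<Sum>c\<in>P. f (fst c + fst v, snd c + snd v))"
  unfolding translate_def by (subst sum.reindex[OF inj_translate]) simp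

lemma translate_translate:
  "translate v (translate w P) = translate (fst v + fst w, snd v + snd w) P"
  by (auto simp: translate_def image_image algebra_simps)

lemma translate_zero: "translate (0, 0) P = P"
  by (simp add: translate_def)

lemma single_mult_cells_poly:
  "Poly_Mapping.single v z * cells_poly w P = cells_poly (z * w) (translate v P)"
  unfolding cells_poly_def sum_translate sum_distrib_left
  by (intro sum.cong refl) (simp add: mult_single plus_prod_def algebra_simps)

text \<open>By construction closed only under adding one weighted tile, which suits induction; that
  it is an ideal follows from closure of the tile set under translation.\<close>

inductive_set tile_span :: "cell set set \<Rightarrow> laurent set" for \<T> where
  zero: "0 \<in> tile_span \<T>"
| step: "f \<in> tile_span \<T> \<Longrightarrow> T \<in> \<T> \<Longrightarrow> f + cells_poly z T \<in> tile_span \<T>"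

lemma tile_span_cells_poly: "T \<in> \<T> \<Longrightarrow> cells_poly z T \<in> tile_span \<T>"
  using tile_span.step[OF tile_span.zero] by simp

lemma tile_span_add:
  assumes "f \<in> tile_span \<T>" "g \<in> tile_span \<T>"
  shows "f + g \<in> tile_span \<T>"
  using assms(2)
proof induction
  case zero
  then show ?case using assms(1) by simp
next
  case (step g T z)
  then show ?case using tile_span.step[of "f + g" \<T> T z] by (simp add: add.assoc)
qed

definition translation_closed :: "cell set set \<Rightarrow> bool" where
  "translation_closed \<T> \<longleftrightarrow> (\<forall>v. \<forall>T\<in>\<T>. translate v T \<in> \<T>)"

lemma tile_span_single_mult:
  assumes "translation_closed \<T>" "f \<in> tile_span \<T>"
  shows "Poly_Mapping.single v z * f \<in> tile_span \<T>"
  using assms(2)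
proof induction
  case zero
  then show ?case by (simp add: tile_span.zero)
next
  case (step f T w)
  have "translate v T \<in> \<T>"
    using assms(1) step.hyps(2) unfolding translation_closed_def by blast
  then show ?case
    using step.IH by (simp add: distrib_left single_mult_cells_poly tile_span.step)
qed

text \<open>Every Laurent polynomial is a sum of weighted monomials, and a monomial acts on tiles by
  translation.\<close>

lemma tile_span_mult:
  assumes "translation_closed \<T>" "f \<in> tile_span \<T>"
  shows "g * f \<in> tile_span \<T>"
proof (induction g rule: update_induct)
  case const
  then show ?case by (simp add: tile_span.zero)
next
  case (update g v z)
  \<comment> \<open>The key \<open>v\<close> is new to \<open>g\<close>, so the update is an
    addition.\<close>
  have "Poly_Mapping.update v z g = g + Poly_Mapping.single v z"
    using update.hyps(1)
    by (intro poly_mapping_eqI) (auto simp: lookup_update lookup_add lookup_single in_keys_iff when_def)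
  then show ?case
    using update.IH tile_span_single_mult[OF assms] by (simp add: distrib_right tile_span_add)
qed

lemma tile_span_dvd:
  assumes "translation_closed \<T>" "f \<in> tile_span \<T>" "f dvd g"
  shows "g \<in> tile_span \<T>"
  using assms by (metis dvdE mult.commute tile_span_mult)

lemma tile_span_diff:
  assumes "translation_closed \<T>" "f \<in> tile_span \<T>" "g \<in> tile_span \<T>"
  shows "f - g \<in> tile_span \<T>"
  using tile_span_add[OF assms(2) tile_span_mult[OF assms(1,3), of "- 1"]] by simp

text \<open>Reads tile weights off a combination of tile polynomials; a tile used several times gets
  the sum of its weights.\<close>

lemma tile_span_signed_tiling:
  assumes "f \<in> tile_span \<T>" "\<And>T. T \<in> \<T> \<Longrightarrow> finite T"
  shows "\<exists>F w. finite F \<and> F \<subseteq> \<T> \<and> (\<forall>c. (\<Sum>T | T \<in> F \<and> c \<in> T. w T) = Poly_Mapping.lookup f c)"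
  using assms(1)
proof induction
  case zero
  show ?case by (intro exI[of _ "{}"]) simp
next
  case (step f T z)
  then obtain F w where F: "finite F" "F \<subseteq> \<T>"
    and w: "\<And>c. (\<Sum>T | T \<in> F \<and> c \<in> T. w T) = Poly_Mapping.lookup f c"
    by blast
  \<comment> \<open>\<open>T\<close> may already lie in \<open>F\<close>, so \<open>z\<close> is
    added to its weight; \<open>w\<close> is cut to 0 outside \<open>F\<close>, where its values are
    arbitrary.\<close>
  define w' where "w' S = (if S \<in> F then w S else 0) + (if S = T then z else 0)" for S
  have "(\<Sum>S | S \<in> insert T F \<and> c \<in> S. w' S) = Poly_Mapping.lookup (f + cells_poly z T) c" for c
  proof -
    let ?A = "{S. S \<in> insert T F \<and> c \<in> S}"
    have fin: "finite ?A" using F(1) by simp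
    have "(\<Sum>S\<in>?A. w' S) = (\<Sum>S\<in>?A. if S \<in> F then w S else 0) + (\<Sum>S\<in>?A. if S = T then z else 0)"
      by (simp add: w'_def sum.distrib)
    also have "(\<Sum>S\<in>?A. if S \<in> F then w S else 0) = (\<Sum>S | S \<in> F \<and> c \<in> S. w S)"
      using fin by (intro sum.mono_neutral_cong_right) auto
    also have "(\<Sum>S\<in>?A. if S = T then z else 0) = (if c \<in> T then z else 0)"
      using fin by (simp add: sum.delta)
    finally show ?thesis
      using w assms(2)[OF step.hyps(2)] by (simp add: lookup_add lookup_cells_poly)
  qed
  then show ?case
    using F step.hyps(2) by (intro exI[of _ "insert T F"] exI[of _ w']) auto
qed

lemma admits_signed_tilingI:
  assumes "cells_poly 1 R \<in> tile_span \<T>" "\<And>T. T \<in> \<T> \<Longrightarrow> finite T" "finite R"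
  shows "admits_signed_tiling \<T> R"
  using tile_span_signed_tiling[OF assms(1,2)] assms(3)
  by (auto simp: admits_signed_tiling_def signed_tiling_def lookup_cells_poly)

section \<open>Tileable rectangles\<close>

text \<open>The factor theorem for the root -1 of \<open>y ^ (2 * k + 1) + 1\<close>.\<close>

lemma odd_power_add_one: "\<exists>K. y ^ (2 * k + 1) = - 1 + (1 + y) * K" for y :: "'a::comm_ring_1"
proof (induction k)
  case 0
  show ?case by (intro exI[of _ 1]) simp
next
  case (Suc k)
  then obtain K where K: "y ^ (2 * k + 1) = - 1 + (1 + y) * K" by blast
  have "y ^ (2 * Suc k + 1) = y^2 * y ^ (2 * k + 1)"
    by (simp add: power2_eq_square algebra_simps)
  also have "\<dots> = - 1 + (1 + y) * ((1 - y) + y^2 * K)"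
    unfolding K by (simp add: power2_eq_square algebra_simps)
  finally show ?case by blast
qed

text \<open>First-order Taylor expansion at -1: the value is 1 and the derivative is 1 - 2 + 3 - ...
  - 2k = -k.\<close>

lemma geometric_sum_expand_at_minus_one:
  "\<exists>H. (\<Sum>j\<le>2*k. y ^ j) = 1 - of_nat k * (1 + y) + (1 + y)^2 * H" for y :: "'a::comm_ring_1"
proof (induction k)
  case 0
  show ?case by (intro exI[of _ 0]) simp
next
  case (Suc k)
  then obtain H where H: "(\<Sum>j\<le>2*k. y ^ j) = 1 - of_nat k * (1 + y) + (1 + y)^2 * H" by blast
  obtain K where K: "y ^ (2 * k + 1) = - 1 + (1 + y) * K"
    using odd_power_add_one by blast
  \<comment> \<open>The two new terms are a multiple of \<open>1 + y\<close>, so modulo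
    \<open>(1 + y)^2\<close> their odd power counts as -1.\<close>
  have "(\<Sum>j\<le>2*Suc k. y ^ j) = (\<Sum>j\<le>2*k. y ^ j) + (1 + y) * y ^ (2 * k + 1)"
    by (simp add: algebra_simps)
  also have "\<dots> = 1 - of_nat (Suc k) * (1 + y) + (1 + y)^2 * (H + K)"
    unfolding H K by (simp add: power2_eq_square algebra_simps)
  finally show ?case by blast
qed

section \<open>The two dominoes in the ideal\<close>

abbreviation X :: laurent where "X \<equiv> Poly_Mapping.single (1, 0) 1"
abbreviation Y :: laurent where "Y \<equiv> Poly_Mapping.single (0, 1) 1"

lemma X_power: "X ^ j = Poly_Mapping.single (int j, 0) 1"
  by (induction j) (simp_all add: mult_single plus_prod_def zero_prod_def flip: single_one)

lemma Y_power: "Y ^ j = Poly_Mapping.single (0, int j) 1"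
  by (induction j) (simp_all add: mult_single plus_prod_def zero_prod_def flip: single_one)

lemma dominoes_in_tile_span:
  assumes closed: "translation_closed \<T>" and "k \<ge> 2"
    and square: "(1 + X) * (1 + Y) \<in> tile_span \<T>"
    and vertical: "(\<Sum>j\<le>2*k. Y ^ j) + X \<in> tile_span \<T>"
    and horizontal: "(\<Sum>i\<le>2*k. X ^ i) + Y \<in> tile_span \<T>"
  shows "1 + X \<in> tile_span \<T>" and "1 + Y \<in> tile_span \<T>"
proof -
  define u v where "u = 1 + X" and "v = 1 + Y"
  note mult = tile_span_mult[OF closed] and diff = tile_span_diff[OF closed]
  obtain H where H: "(\<Sum>j\<le>2*k. Y ^ j) = 1 - of_nat k * v + v^2 * H"
    using geometric_sum_expand_at_minus_one[of Y k] unfolding v_def by blast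
  obtain H' where H': "(\<Sum>j\<le>2*k. X ^ j) = 1 - of_nat k * u + u^2 * H'"
    using geometric_sum_expand_at_minus_one[of X k] unfolding u_def by blast
  have uv: "u * v \<in> tile_span \<T>"
    using square by (simp add: u_def v_def)
  have P: "u - of_nat k * v + v^2 * H \<in> tile_span \<T>"
    using vertical unfolding H by (simp add: u_def algebra_simps)
  have P': "v - of_nat k * u + u^2 * H' \<in> tile_span \<T>"
    using horizontal unfolding H' by (simp add: v_def algebra_simps)
  \<comment> \<open>Multiplying \<open>P\<close> by \<open>u\<close> leaves \<open>u^2\<close> plus
    multiples of \<open>u * v\<close>, which are subtracted.\<close>
  have "u^2 = u * (u - of_nat k * v + v^2 * H) - (v * H - of_nat k) * (u * v)"
    by (simp add: power2_eq_square algebra_simps)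
  then have u2: "u^2 \<in> tile_span \<T>"
    using diff[OF mult[OF P] mult[OF uv]] by simp
  have "v^2 = v * (v - of_nat k * u + u^2 * H') - (u * H' - of_nat k) * (u * v)"
    by (simp add: power2_eq_square algebra_simps)
  then have v2: "v^2 \<in> tile_span \<T>"
    using diff[OF mult[OF P'] mult[OF uv]] by simp
  have Q: "u - of_nat k * v \<in> tile_span \<T>"
    using diff[OF P mult[OF v2, of H]] by (simp add: algebra_simps)
  have Q': "v - of_nat k * u \<in> tile_span \<T>"
    using diff[OF P' mult[OF u2, of H']] by (simp add: algebra_simps)
  \<comment> \<open>\<open>Q\<close> and \<open>Q'\<close> are linear in \<open>u\<close> and
    \<open>v\<close>; eliminating \<open>v\<close> leaves \<open>u\<close> times their
    determinant.\<close>
  have "u - of_nat k * v + of_nat k * (v - of_nat k * u) \<in> tile_span \<T>"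
    using tile_span_add[OF Q mult[OF Q']] .
  also have "u - of_nat k * v + of_nat k * (v - of_nat k * u) = (1 - of_nat k * of_nat k) * u"
    by (simp add: algebra_simps)
  \<comment> \<open>As a constant monomial the factor can be inverted by inverting a complex
    number.\<close>
  also have "1 - of_nat k * of_nat k = Poly_Mapping.single (0::cell) (1 - of_nat k * of_nat k :: complex)"
    by (simp add: single_diff mult_single flip: single_of_nat single_one)
  finally have R: "Poly_Mapping.single 0 (1 - of_nat k * of_nat k) * u \<in> tile_span \<T>" .
  \<comment> \<open>The value \<open>k = 1\<close>, which belongs to n = 4, is excluded
    here.\<close>
  have "k * k \<noteq> 1"
    using \<open>k \<ge> 2\<close> by simp
  then have nz: "1 - of_nat k * of_nat k \<noteq> (0::complex)"
    by (metis eq_iff_diff_eq_0 of_nat_1 of_nat_eq_iff of_nat_mult)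
  define d :: complex where "d = 1 - of_nat k * of_nat k"
  have "Poly_Mapping.single (0::cell) (inverse d) * Poly_Mapping.single 0 d = 1"
    using nz by (simp add: mult_single d_def)
  then have "u = Poly_Mapping.single 0 (inverse d) * (Poly_Mapping.single 0 d * u)"
    by (metis mult.assoc mult_1)
  then have u: "u \<in> tile_span \<T>"
    using mult[OF R[folded d_def]] by metis
  then show "1 + X \<in> tile_span \<T>" by (simp add: u_def)
  have "v \<in> tile_span \<T>"
    using tile_span_add[OF Q' mult[OF u, of "of_nat k"]] by simp
  then show "1 + Y \<in> tile_span \<T>" by (simp add: v_def)
qed

section \<open>Rectangles as products of a row and a column\<close>

lemma cells_poly_rectangle:
  "cells_poly 1 (rectangle a b p q) =
     (\<Sum>i\<in>{a..<a + int p}. Poly_Mapping.single (i, 0) 1) * (\<Sum>j\<in>{b..<b + int q}. Poly_Mapping.single (0, j) 1)"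
  by (simp add: cells_poly_def rectangle_def sum_product sum.cartesian_product mult_single plus_prod_def
      case_prod_unfold)

lemma atLeastLessThan_int_Suc: "{a..<a + int (Suc p)} = insert (a + int p) {a..<a + int p}"
  by auto

text \<open>A row of even length splits into horizontal dominoes, each a monomial times
  \<open>1 + X\<close>.\<close>

lemma one_plus_X_dvd_row:
  assumes "even p"
  shows "1 + X dvd (\<Sum>i\<in>{a..<a + int p}. Poly_Mapping.single (i, 0) 1)"
proof -
  have "1 + X dvd (\<Sum>i\<in>{a..<a + int (2 * r)}. Poly_Mapping.single (i, 0) 1)" for r
  proof (induction r)
    case (Suc r)
    have "(\<Sum>i\<in>{a..<a + int (2 * Suc r)}. Poly_Mapping.single (i, 0) 1) =
      (\<Sum>i\<in>{a..<a + int (2 * r)}. Poly_Mapping.single (i, 0) 1)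
        + (1 + X) * Poly_Mapping.single (a + int (2 * r), 0) 1"
      using atLeastLessThan_int_Suc[of a "2 * r"] atLeastLessThan_int_Suc[of a "2 * r + 1"]
      by (simp add: distrib_right mult_single plus_prod_def algebra_simps)
    then show ?case using Suc by (metis dvd_add dvd_triv_left)
  qed simp
  then show ?thesis using assms by (metis evenE)
qed

lemma one_plus_Y_dvd_column:
  assumes "even q"
  shows "1 + Y dvd (\<Sum>j\<in>{b..<b + int q}. Poly_Mapping.single (0, j) 1)"
proof -
  have "1 + Y dvd (\<Sum>j\<in>{b..<b + int (2 * r)}. Poly_Mapping.single (0, j) 1)" for r
  proof (induction r)
    case (Suc r)
    have "(\<Sum>j\<in>{b..<b + int (2 * Suc r)}. Poly_Mapping.single (0, j) 1) =
      (\<Sum>j\<in>{b..<b + int (2 * r)}. Poly_Mapping.single (0, j) 1)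
        + (1 + Y) * Poly_Mapping.single (0, b + int (2 * r)) 1"
      using atLeastLessThan_int_Suc[of b "2 * r"] atLeastLessThan_int_Suc[of b "2 * r + 1"]
      by (simp add: distrib_right mult_single plus_prod_def algebra_simps)
    then show ?case using Suc by (metis dvd_add dvd_triv_left)
  qed simp
  then show ?thesis using assms by (metis evenE)
qed

section \<open>Polynomials of the tiles\<close>

lemma L_polyominoes_image:
  "L_polyominoes n =
    {Pair 0 ` {0..int n - 2} \<union> {(1, 0)},
     Pair 1 ` {0..int n - 2} \<union> {(0, int n - 2)},
     (\<lambda>i. (i, 0)) ` {0..int n - 2} \<union> {(0, 1)},
     (\<lambda>i. (i, 1)) ` {0..int n - 2} \<union> {(int n - 2, 0)}}"
proof -
  have "{f j |j. 0 \<le> j \<and> j \<le> int n - 2} = f ` {0..int n - 2}" for f :: "int \<Rightarrow> cell"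
    by auto
  then show ?thesis by (simp add: L_polyominoes_def)
qed

lemma translation_closed_tiles_plus: "translation_closed (tiles_plus n)"
  unfolding translation_closed_def tiles_plus_def tiles_def translates_def
  using translate_translate by blast

lemma finite_tiles_plus: "T \<in> tiles_plus n \<Longrightarrow> finite T"
  by (auto simp: tiles_plus_def tiles_def translates_def L_polyominoes_image square2_def
      intro!: finite_translate)

lemma finite_rectangle: "finite (rectangle a b p q)"
  by (simp add: rectangle_def)

lemma L_polyominoes_subset_tiles_plus: "P \<in> L_polyominoes n \<Longrightarrow> P \<in> tiles_plus n"
  unfolding tiles_plus_def tiles_def translates_def using translate_zero by blast

lemma square2_in_tiles_plus: "square2 \<in> tiles_plus n"
  unfolding tiles_plus_def translates_def using translate_zero by blast

lemma square_in_tile_span: "(1 + X) * (1 + Y) \<in> tile_span (tiles_plus n)"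
proof -
  have "(1 + X) * (1 + Y) = cells_poly 1 square2"
    by (simp add: cells_poly_def square2_def algebra_simps mult_single plus_prod_def zero_prod_def
        flip: single_one)
  then show ?thesis
    using tile_span_cells_poly[OF square2_in_tiles_plus] by simp
qed

lemma atLeastAtMost_int_eq_image: "{0..2 * int k} = int ` {..2 * k}"
proof (intro equalityI subsetI)
  fix i assume "i \<in> {0..2 * int k}"
  then have "i = int (nat i)" "nat i \<le> 2 * k" by auto
  then show "i \<in> int ` {..2 * k}" by blast
qed auto

text \<open>These are the two shapes with their corner at the origin. The leg has n - 1 = 2k + 1
  cells, which gives the geometric sum; the extra cell is \<open>X\<close> or
  \<open>Y\<close>.\<close>

lemma L_tiles_in_tile_span:
  assumes "n = 2 * k + 2"
  shows "(\<Sum>j\<le>2*k. Y ^ j) + X \<in> tile_span (tiles_plus n)"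
    and "(\<Sum>i\<le>2*k. X ^ i) + Y \<in> tile_span (tiles_plus n)"
proof -
  have I: "{0..int n - 2} = int ` {..2 * k}"
    using atLeastAtMost_int_eq_image[of k] assms by simp
  have "cells_poly 1 (Pair 0 ` int ` {..2 * k} \<union> {(1, 0)}) = (\<Sum>j\<le>2*k. Y ^ j) + X"
    unfolding cells_poly_def
    by (subst sum.union_disjoint) (auto simp: image_image sum.reindex inj_on_def Y_power)
  then show "(\<Sum>j\<le>2*k. Y ^ j) + X \<in> tile_span (tiles_plus n)"
    using tile_span_cells_poly[OF L_polyominoes_subset_tiles_plus, of "Pair 0 ` int ` {..2 * k} \<union> {(1, 0)}" n 1]
    by (simp add: L_polyominoes_image I)
  have "cells_poly 1 ((\<lambda>i. (i, 0)) ` int ` {..2 * k} \<union> {(0, 1)}) = (\<Sum>i\<le>2*k. X ^ i) + Y"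
    unfolding cells_poly_def
    by (subst sum.union_disjoint) (auto simp: image_image sum.reindex inj_on_def X_power)
  then show "(\<Sum>i\<le>2*k. X ^ i) + Y \<in> tile_span (tiles_plus n)"
    using tile_span_cells_poly[OF L_polyominoes_subset_tiles_plus, of "(\<lambda>i. (i, 0)) ` int ` {..2 * k} \<union> {(0, 1)}" n 1]
    by (simp add: L_polyominoes_image I)
qed

lemma admits_signed_tiling_rectangle_if_poly_dvd:
  assumes "f \<in> tile_span (tiles_plus n)" "f dvd cells_poly 1 (rectangle a b p q)"
  shows "admits_signed_tiling (tiles_plus n) (rectangle a b p q)"
  using admits_signed_tilingI[OF tile_span_dvd[OF translation_closed_tiles_plus assms]
      finite_tiles_plus finite_rectangle] by simp

text \<open>Amounts to cutting the rectangle into 2x2 squares, which works for every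
  \<open>n\<close>.\<close>

lemma admits_signed_tiling_even_even:
  assumes "even p" "even q"
  shows "admits_signed_tiling (tiles_plus n) (rectangle a b p q)"
  by (rule admits_signed_tiling_rectangle_if_poly_dvd[OF square_in_tile_span])
    (simp add: cells_poly_rectangle mult_dvd_mono one_plus_X_dvd_row one_plus_Y_dvd_column assms)

text \<open>One even side suffices because a single domino polynomial then divides the row or the
  column factor.\<close>

lemma admits_signed_tiling_even:
  assumes "n \<ge> 6" "even n" "even p \<or> even q"
  shows "admits_signed_tiling (tiles_plus n) (rectangle a b p q)"
proof -
  define k where "k = (n - 2) div 2"
  have k: "n = 2 * k + 2" "k \<ge> 2"
    using assms(1,2) by (auto simp: k_def)
  note dominoes = dominoes_in_tile_span[OF translation_closed_tiles_plus k(2) square_in_tile_span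
      L_tiles_in_tile_span[OF k(1)]]
  show ?thesis
    using assms(3)
  proof
    assume "even p"
    then show ?thesis
      by (intro admits_signed_tiling_rectangle_if_poly_dvd[OF dominoes(1)])
        (simp add: cells_poly_rectangle one_plus_X_dvd_row)
  next
    assume "even q"
    then show ?thesis
      by (intro admits_signed_tiling_rectangle_if_poly_dvd[OF dominoes(2)])
        (simp add: cells_poly_rectangle one_plus_Y_dvd_column)
  qed
qed

section \<open>Obstructions\<close>

text \<open>Summation against \<phi> is a linear functional that vanishes on every tile, hence on
  every signed combination of tiles.\<close>

lemma signed_tiling_annihilator:
  assumes "admits_signed_tiling \<T> R" "finite R" "\<And>T. T \<in> \<T> \<Longrightarrow> finite T"
    and zero: "\<And>T. T \<in> \<T> \<Longrightarrow> (\<Sum>c\<in>T. \<phi> c) = (0::complex)"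
  shows "(\<Sum>c\<in>R. \<phi> c) = 0"
proof -
  obtain F w where tiling: "signed_tiling \<T> R F w"
    using assms(1) unfolding admits_signed_tiling_def by blast
  then have F: "finite F" "F \<subseteq> \<T>"
    by (simp_all add: signed_tiling_def)
  have w: "(\<Sum>T | T \<in> F \<and> c \<in> T. w T) = (if c \<in> R then 1 else 0)" for c
    using tiling unfolding signed_tiling_def by (elim conjE) (erule spec)
  \<comment> \<open>One finite set containing \<open>R\<close> and all tiles of \<open>F\<close>, so
    that the two sums have independent ranges and can be swapped.\<close>
  define U where "U = R \<union> \<Union>F"
  have U: "finite U"
    using F assms(2,3) by (auto simp: U_def)
  have "(\<Sum>c\<in>R. \<phi> c) = (\<Sum>c\<in>U. (if c \<in> R then 1 else 0) * \<phi> c)"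
    using U by (intro sum.mono_neutral_cong_left) (auto simp: U_def)
  also have "\<dots> = (\<Sum>c\<in>U. (\<Sum>T\<in>F. if c \<in> T then w T * \<phi> c else 0))"
    unfolding w[symmetric] sum_distrib_right using F(1)
    by (intro sum.cong refl sum.mono_neutral_cong_left) auto
  also have "\<dots> = (\<Sum>T\<in>F. (\<Sum>c\<in>U. if c \<in> T then w T * \<phi> c else 0))"
    by (rule sum.swap)
  also have "\<dots> = (\<Sum>T\<in>F. w T * (\<Sum>c\<in>T. \<phi> c))"
    unfolding sum_distrib_left using U
    by (intro sum.cong refl sum.mono_neutral_cong_right) (auto simp: U_def)
  also have "\<dots> = 0"
    using zero F(2) by (intro sum.neutral) auto
  finally show ?thesis .
qed

section \<open>Alternating sums over rectangles\<close>

text \<open>The sign (-1)^i, given by parity since \<open>i\<close> may be negative;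
  \<open>alt (i + j)\<close> is the value of x^i y^j at (-1,-1).\<close>

definition alt :: "int \<Rightarrow> complex" where
  "alt i = (if even i then 1 else - 1)"

lemma alt_add: "alt (i + j) = alt i * alt j"
  by (simp add: alt_def)

lemma alt_nonzero: "alt i \<noteq> 0"
  by (simp add: alt_def)

lemma sum_alt: "(\<Sum>i\<in>{a..<a + int p}. alt i) = (if even p then 0 else alt a)"
  by (induction p) (simp_all only: atLeastLessThan_int_Suc, simp_all add: alt_def)

text \<open>Neighbours i, i + 1 contribute -\<open>alt i\<close>, which is -\<open>alt a\<close>
  since pairs start at even distance from \<open>a\<close>; there are p/2 pairs. The result is
  nonzero for positive \<open>p\<close>.\<close>

lemma sum_mult_alt:
  assumes "even p"
  shows "(\<Sum>i\<in>{a..<a + int p}. of_int i * alt i) = - alt a * of_nat p / 2"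
proof -
  have "(\<Sum>i\<in>{a..<a + int (2 * r)}. of_int i * alt i) = - alt a * of_nat r" for r
  proof (induction r)
    case (Suc r)
    then show ?case
      using atLeastLessThan_int_Suc[of a "2 * r"] atLeastLessThan_int_Suc[of a "2 * r + 1"]
      by (simp add: algebra_simps alt_def)
  qed simp
  then show ?thesis using assms by (auto elim!: evenE)
qed

lemma sum_alt_rectangle:
  "(\<Sum>c\<in>rectangle a b p q. alt (fst c + snd c)) = (if even p \<or> even q then 0 else alt a * alt b)"
proof -
  have "(\<Sum>c\<in>rectangle a b p q. alt (fst c + snd c)) =
      (\<Sum>i\<in>{a..<a + int p}. alt i) * (\<Sum>j\<in>{b..<b + int q}. alt j)"
    by (simp add: rectangle_def sum_product sum.cartesian_product alt_add case_prod_unfold)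
  then show ?thesis by (simp add: sum_alt)
qed

text \<open>The product rule: the factor i + j comes from x d/dx + y d/dy, applied to the row times
  the column and evaluated at (-1,-1).\<close>

lemma sum_mult_alt_rectangle:
  "(\<Sum>c\<in>rectangle a b p q. of_int (fst c + snd c) * alt (fst c + snd c)) =
    (\<Sum>i\<in>{a..<a + int p}. of_int i * alt i) * (\<Sum>j\<in>{b..<b + int q}. alt j) +
    (\<Sum>i\<in>{a..<a + int p}. alt i) * (\<Sum>j\<in>{b..<b + int q}. of_int j * alt j)"
  unfolding rectangle_def sum_product sum.cartesian_product sum.distrib[symmetric]
  by (intro sum.cong refl) (simp add: alt_add case_prod_unfold algebra_simps)

section \<open>Alternating sums over tiles\<close>

text \<open>The leg has an odd number of cells, so its signs add up to the sign of its end cells;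
  the extra cell neighbours an end cell and has the opposite sign.\<close>

lemma sum_alt_L_polyomino:
  assumes "even n" "n \<ge> 4" "P \<in> L_polyominoes n"
  shows "(\<Sum>c\<in>P. alt (fst c + snd c)) = 0"
proof -
  have I: "(\<Sum>j\<in>{0..int n - 2}. alt j) = 1"
  proof -
    \<comment> \<open>The half-open form used by \<open>sum_alt\<close>, with the odd length n -
      1.\<close>
    have "{0..int n - 2} = {0..<0 + int (n - 1)}" using assms(2) by auto
    then show ?thesis using assms(1,2) by (simp only: sum_alt) (simp add: alt_def)
  qed
  have alt: "alt 1 = - 1" "alt (int n - 2) = 1" using assms(1) by (simp_all add: alt_def)
  have sum_insert_image: "(\<Sum>c\<in>f ` {0..int n - 2} \<union> {d}. alt (fst c + snd c)) =
      alt (fst d + snd d) + (\<Sum>i\<in>{0..int n - 2}. alt (fst (f i) + snd (f i)))"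
    if "inj f" "d \<notin> range f" for f :: "int \<Rightarrow> cell" and d
    using that by (subst sum.union_disjoint) (auto simp: sum.reindex inj_on_def)
  have shifted: "(\<Sum>j\<in>{0..int n - 2}. alt (1 + j)) = - 1" "(\<Sum>j\<in>{0..int n - 2}. alt (j + 1)) = - 1"
    by (simp_all add: alt_add alt I sum_negf)
  show ?thesis
    using assms(3) unfolding L_polyominoes_image
    by (elim insertE emptyE; hypsubst; subst sum_insert_image)
      (simp_all add: inj_def image_iff I shifted alt)
qed

lemma sum_alt_tiles_plus:
  assumes "even n" "n \<ge> 4" "T \<in> tiles_plus n"
  shows "(\<Sum>c\<in>T. alt (fst c + snd c)) = 0"
proof -
  obtain v P where T: "T = translate v P" and P: "P \<in> L_polyominoes n \<or> P = square2"
    using assms(3) by (auto simp: tiles_plus_def tiles_def translates_def)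
  have "(\<Sum>c\<in>P. alt (fst c + snd c)) = 0"
    using P sum_alt_L_polyomino[OF assms(1,2)] by (auto simp: square2_def alt_def)
  moreover have "(\<Sum>c\<in>T. alt (fst c + snd c)) = (\<Sum>c\<in>P. alt (fst c + snd c)) * alt (fst v + snd v)"
    unfolding T sum_translate sum_distrib_right by (simp add: alt_add algebra_simps)
  ultimately show ?thesis by simp
qed

text \<open>Special to n = 4: for n = 2k + 2 the sum over each shape is k - 1.\<close>

lemma sum_mult_alt_L_polyomino_4:
  assumes "P \<in> L_polyominoes 4"
  shows "(\<Sum>c\<in>P. of_int (fst c + snd c) * alt (fst c + snd c)) = 0"
proof -
  have "{0..2::int} = {0, 1, 2}" by auto
  then show ?thesis
    using assms by (auto simp: L_polyominoes_image alt_def)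
qed

lemma sum_mult_alt_tiles_plus_4:
  assumes "T \<in> tiles_plus 4"
  shows "(\<Sum>c\<in>T. of_int (fst c + snd c) * alt (fst c + snd c)) = 0"
proof -
  obtain v P where T: "T = translate v P" and P: "P \<in> L_polyominoes 4 \<or> P = square2"
    using assms by (auto simp: tiles_plus_def tiles_def translates_def)
  have "(\<Sum>c\<in>P. alt (fst c + snd c)) = 0"
    using P sum_alt_L_polyomino[of 4] by (auto simp: square2_def alt_def)
  moreover have "(\<Sum>c\<in>P. of_int (fst c + snd c) * alt (fst c + snd c)) = 0"
    using P sum_mult_alt_L_polyomino_4 by (auto simp: square2_def alt_def)
  \<comment> \<open>Translation shifts i + j by a constant, which adds a multiple of the plain
    alternating sum; hence the vanishing of both sums over \<open>P\<close> is used.\<close>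
  moreover have "(\<Sum>c\<in>T. of_int (fst c + snd c) * alt (fst c + snd c)) =
      (\<Sum>c\<in>P. of_int (fst c + snd c) * alt (fst c + snd c)) * alt (fst v + snd v) +
      (\<Sum>c\<in>P. alt (fst c + snd c)) * (of_int (fst v + snd v) * alt (fst v + snd v))"
    unfolding T sum_translate sum_distrib_right sum.distrib[symmetric]
    by (intro sum.cong refl) (simp add: alt_add algebra_simps)
  ultimately show ?thesis by simp
qed

section \<open>Parity of the sides of a tileable rectangle\<close>

lemma even_if_admits_signed_tiling:
  assumes "even n" "n \<ge> 4" "admits_signed_tiling (tiles_plus n) (rectangle a b p q)"
  shows "even p \<or> even q"
proof -
  have "(\<Sum>c\<in>rectangle a b p q. alt (fst c + snd c)) = 0"
    by (rule signed_tiling_annihilator[OF assms(3) finite_rectangle finite_tiles_plus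
          sum_alt_tiles_plus[OF assms(1,2)]])
  then show ?thesis
    by (simp add: sum_alt_rectangle alt_nonzero split: if_splits)
qed

text \<open>If exactly one side were even, one of the two products would be 0 and the other not.
  Positivity matters: an empty rectangle is tileable whatever its other side.\<close>

lemma even_even_if_admits_signed_tiling_4:
  assumes "p \<ge> 1" "q \<ge> 1" "admits_signed_tiling (tiles_plus 4) (rectangle a b p q)"
  shows "even p \<and> even q"
proof -
  have "even p \<or> even q"
    using even_if_admits_signed_tiling[OF _ _ assms(3)] by simp
  moreover have "(\<Sum>i\<in>{a..<a + int p}. of_int i * alt i) * (\<Sum>j\<in>{b..<b + int q}. alt j) +
    (\<Sum>i\<in>{a..<a + int p}. alt i) * (\<Sum>j\<in>{b..<b + int q}. of_int j * alt j) = 0"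
    using signed_tiling_annihilator[OF assms(3) finite_rectangle finite_tiles_plus
        sum_mult_alt_tiles_plus_4]
    by (simp only: sum_mult_alt_rectangle)
  ultimately show ?thesis
    using assms(1,2) by (auto simp: sum_alt sum_mult_alt alt_nonzero split: if_splits)
qed

theorem theorem4:
  fixes p q :: nat and a b :: int
  assumes "p \<ge> 1" and "q \<ge> 1"
  shows "(\<forall>n\<ge>6. even n \<longrightarrow>
            (admits_signed_tiling (tiles_plus n) (rectangle a b p q) \<longleftrightarrow> even p \<or> even q)) \<and>
         (admits_signed_tiling (tiles_plus 4) (rectangle a b p q) \<longleftrightarrow> even p \<and> even q)"
proof (intro conjI allI impI iffI)
  fix n :: nat
  assume n: "n \<ge> 6" "even n"
  show "even p \<or> even q" if "admits_signed_tiling (tiles_plus n) (rectangle a b p q)"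
    using even_if_admits_signed_tiling[OF n(2) _ that] n(1) by simp
  show "admits_signed_tiling (tiles_plus n) (rectangle a b p q)" if "even p \<or> even q"
    using admits_signed_tiling_even[OF n that] .
next
  assume "admits_signed_tiling (tiles_plus 4) (rectangle a b p q)"
  then have "even p \<and> even q"
    using even_even_if_admits_signed_tiling_4 assms by blast
  then show "even p" "even q" by simp_all
next
  assume "even p \<and> even q"
  then show "admits_signed_tiling (tiles_plus 4) (rectangle a b p q)"
    using admits_signed_tiling_even_even by blast
qed

end
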